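(* Let $S$ be a $\Gamma$-semigroup with unities, let $R$ be its right operator semigroup, and let $Q$ be any non-empty set. If $\mu$ is a $Q$-fuzzy ideal (respectively $Q$-fuzzy left ideal) of $R$, then $\mu^{*}$ is a $Q$-fuzzy ideal (respectively $Q$-fuzzy left ideal) of $S$.
   Context: $\Gamma$-semigroup: non-empty sets $S$ and $\Gamma$ together with mappings $S\times\Gamma\times S\to S$, $(a,\alpha,b)\mapsto a\alpha b$, and $\Gamma\times S\times\Gamma\to\Gamma$, $(\alpha,a,\beta)\mapsto\alpha a\beta$, such that $(a\alpha b)\beta c=a(\alpha b\beta)c=a\alpha(b\beta c)$ and $\alpha(a\beta b)\gamma=(\alpha a\beta)b\gamma=\alpha a(\beta b\gamma)$ for all $a,b,c\in S$ and $\alpha,\beta,\gamma\in\Gamma$; one says $S$ is a $\Gamma$-semigroup. Operator semigroups: on $S\times\Gamma$ define the equivalence relation $(x,\alpha)\rho(y,\beta)$ iff $x\alpha s=y\beta s$ for all $s\in S$ and $\gamma x\alpha=\gamma y\beta$ for all $\gamma\in\Gamma$; write $[x,\alpha]$ for the class of $(x,\alpha)$. The left operator semigroup is $L=\{[x,\alpha]:x\in S,\alpha\in\Gamma\}$ with multiplication $[x,\alpha][y,\beta]=[x\alpha y,\beta]$. Dually, the right operator semigroup $R$ consists of the classes $[\alpha,a]$ of pairs in $\Gamma\times S$ under the relation $(\alpha,a)\sim(\beta,b)$ iff $s\alpha a=s\beta b$ for all $s\in S$ and $\alpha a\gamma=\beta b\gamma$ for all $\gamma\in\Gamma$, with multiplication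 $[\alpha,a][\beta,b]=[\alpha a\beta,b]$. A left unity of $S$ is an element $[e,\delta]\in L$ with $e\delta s=s$ for all $s\in S$; a right unity of $S$ is an element $[\gamma,f]\in R$ with $s\gamma f=s$ for all $s\in S$. "$S$ with unities" means that $S$ has a left unity and a right unity. A $Q$-fuzzy subset of a non-empty set $X$ is a function $\mu:X\times Q\to[0,1]$; it is non-empty if it is not identically $0$. A non-empty $Q$-fuzzy subset $\mu$ of $S$ is a $Q$-fuzzy left (right) ideal of $S$ if $\mu(x\gamma y,q)\ge\mu(y,q)$ (respectively $\ge\mu(x,q)$) for all $x,y\in S,\gamma\in\Gamma,q\in Q$, and a $Q$-fuzzy ideal if it is both. For a semigroup $T$ (such as $R$), a non-empty $Q$-fuzzy subset $\mu$ of $T$ is a $Q$-fuzzy left (right) ideal of $T$ if $\mu(xy,q)\ge\mu(y,q)$ (respectively $\ge\mu(x,q)$) for all $x,y\in T,q\in Q$, and a $Q$-fuzzy ideal if it is both. For a $Q$-fuzzy subset $\mu$ of $R$, the $Q$-fuzzy subset $\mu^{*}$ of $S$ is $\mu^{*}(a,q)=\inf_{\gamma\in\Gamma}\mu([\gamma,a],q)$. *)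

theory Defs
  imports Complex_Main "HOL-Library.FuncSet"
begin

section \<open>Gamma-semigroups\<close>

record ('s, 'g) gamma_structure =
  scarrier :: "'s set"
  gcarrier :: "'g set"
  smult :: "'s \<Rightarrow> 'g \<Rightarrow> 's \<Rightarrow> 's"
  gmult :: "'g \<Rightarrow> 's \<Rightarrow> 'g \<Rightarrow> 'g"

locale gamma_semigroup =
  fixes M :: "('s, 'g) gamma_structure"
  assumes S_nonempty: "scarrier M \<noteq> {}"
    and G_nonempty: "gcarrier M \<noteq> {}"
    and S_closed: "\<lbrakk>a \<in> scarrier M; \<alpha> \<in> gcarrier M; b \<in> scarrier M\<rbrakk> \<Longrightarrow> smult M a \<alpha> b \<in> scarrier M"
    and G_closed: "\<lbrakk>\<alpha> \<in> gcarrier M; a \<in> scarrier M; \<beta> \<in> gcarrier M\<rbrakk> \<Longrightarrow> gmult M \<alpha> a \<beta> \<in> gcarrier M"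
    and S_assoc1: "\<lbrakk>a \<in> scarrier M; b \<in> scarrier M; c \<in> scarrier M; \<alpha> \<in> gcarrier M; \<beta> \<in> gcarrier M\<rbrakk>
      \<Longrightarrow> smult M (smult M a \<alpha> b) \<beta> c = smult M a (gmult M \<alpha> b \<beta>) c"
    and S_assoc2: "\<lbrakk>a \<in> scarrier M; b \<in> scarrier M; c \<in> scarrier M; \<alpha> \<in> gcarrier M; \<beta> \<in> gcarrier M\<rbrakk>
      \<Longrightarrow> smult M a (gmult M \<alpha> b \<beta>) c = smult M a \<alpha> (smult M b \<beta> c)"
    and G_assoc1: "\<lbrakk>a \<in> scarrier M; b \<in> scarrier M; \<alpha> \<in> gcarrier M; \<beta> \<in> gcarrier M; \<gamma> \<in> gcarrier M\<rbrakk>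
      \<Longrightarrow> gmult M \<alpha> (smult M a \<beta> b) \<gamma> = gmult M (gmult M \<alpha> a \<beta>) b \<gamma>"
    and G_assoc2: "\<lbrakk>a \<in> scarrier M; b \<in> scarrier M; \<alpha> \<in> gcarrier M; \<beta> \<in> gcarrier M; \<gamma> \<in> gcarrier M\<rbrakk>
      \<Longrightarrow> gmult M (gmult M \<alpha> a \<beta>) b \<gamma> = gmult M \<alpha> a (gmult M \<beta> b \<gamma>)"


section \<open>Operator semigroups and unities\<close>

definition left_rel :: "('s, 'g) gamma_structure \<Rightarrow> (('s \<times> 'g) \<times> ('s \<times> 'g)) set" where
  "left_rel M = {((x, \<alpha>), (y, \<beta>)) | x \<alpha> y \<beta>.
     x \<in> scarrier M \<and> \<alpha> \<in> gcarrier M \<and> y \<in> scarrier M \<and> \<beta> \<in> gcarrier M \<and>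
     (\<forall>s \<in> scarrier M. smult M x \<alpha> s = smult M y \<beta> s) \<and>
     (\<forall>\<gamma> \<in> gcarrier M. gmult M \<gamma> x \<alpha> = gmult M \<gamma> y \<beta>)}"

definition left_class :: "('s, 'g) gamma_structure \<Rightarrow> 's \<Rightarrow> 'g \<Rightarrow> ('s \<times> 'g) set" where
  "left_class M x \<alpha> = left_rel M `` {(x, \<alpha>)}"

definition left_op :: "('s, 'g) gamma_structure \<Rightarrow> ('s \<times> 'g) set set" where
  "left_op M = (scarrier M \<times> gcarrier M) // left_rel M"

definition right_rel :: "('s, 'g) gamma_structure \<Rightarrow> (('g \<times> 's) \<times> ('g \<times> 's)) set" where
  "right_rel M = {((\<alpha>, a), (\<beta>, b)) | \<alpha> a \<beta> b.
     \<alpha> \<in> gcarrier M \<and> a \<in> scarrier M \<and> \<beta> \<in> gcarrier M \<and> b \<in> scarrier M \<and>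
     (\<forall>s \<in> scarrier M. smult M s \<alpha> a = smult M s \<beta> b) \<and>
     (\<forall>\<gamma> \<in> gcarrier M. gmult M \<alpha> a \<gamma> = gmult M \<beta> b \<gamma>)}"

definition right_class :: "('s, 'g) gamma_structure \<Rightarrow> 'g \<Rightarrow> 's \<Rightarrow> ('g \<times> 's) set" where
  "right_class M \<alpha> a = right_rel M `` {(\<alpha>, a)}"

definition right_op :: "('s, 'g) gamma_structure \<Rightarrow> ('g \<times> 's) set set" where
  "right_op M = (gcarrier M \<times> scarrier M) // right_rel M"

text \<open>The union ranges over all representatives; since the product class does not depend on
  them, it is a single class, see \<open>right_mult_class\<close> below.\<close>

definition right_mult ::
    "('s, 'g) gamma_structure \<Rightarrow> ('g \<times> 's) set \<Rightarrow> ('g \<times> 's) set \<Rightarrow> ('g \<times> 's) set" where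
  "right_mult M X Y = (\<Union>(\<alpha>, a) \<in> X. \<Union>(\<beta>, b) \<in> Y. right_class M (gmult M \<alpha> a \<beta>) b)"

definition left_unity :: "('s, 'g) gamma_structure \<Rightarrow> ('s \<times> 'g) set \<Rightarrow> bool" where
  "left_unity M U \<longleftrightarrow> U \<in> left_op M \<and>
     (\<exists>e \<in> scarrier M. \<exists>\<delta> \<in> gcarrier M. U = left_class M e \<delta> \<and>
        (\<forall>s \<in> scarrier M. smult M e \<delta> s = s))"

definition right_unity :: "('s, 'g) gamma_structure \<Rightarrow> ('g \<times> 's) set \<Rightarrow> bool" where
  "right_unity M U \<longleftrightarrow> U \<in> right_op M \<and>
     (\<exists>\<gamma> \<in> gcarrier M. \<exists>f \<in> scarrier M. U = right_class M \<gamma> f \<and>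
        (\<forall>s \<in> scarrier M. smult M s \<gamma> f = s))"

definition with_unities :: "('s, 'g) gamma_structure \<Rightarrow> bool" where
  "with_unities M \<longleftrightarrow> (\<exists>U. left_unity M U) \<and> (\<exists>U. right_unity M U)"

context gamma_semigroup
begin

lemma equiv_left_rel: "equiv (scarrier M \<times> gcarrier M) (left_rel M)"
proof (rule equivI)
  show "left_rel M \<subseteq> (scarrier M \<times> gcarrier M) \<times> (scarrier M \<times> gcarrier M)"
    unfolding left_rel_def by blast
  show "refl_on (scarrier M \<times> gcarrier M) (left_rel M)"
    unfolding left_rel_def refl_on_def by blast
  show "sym (left_rel M)"
    by (rule symI) (clarsimp simp: left_rel_def)
  show "trans (left_rel M)"
    by (rule transI) (clarsimp simp: left_rel_def)
qed

lemma equiv_right_rel: "equiv (gcarrier M \<times> scarrier M) (right_rel M)"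
proof (rule equivI)
  show "right_rel M \<subseteq> (gcarrier M \<times> scarrier M) \<times> (gcarrier M \<times> scarrier M)"
    unfolding right_rel_def by blast
  show "refl_on (gcarrier M \<times> scarrier M) (right_rel M)"
    unfolding right_rel_def refl_on_def by blast
  show "sym (right_rel M)"
    by (rule symI) (clarsimp simp: right_rel_def)
  show "trans (right_rel M)"
    by (rule transI) (clarsimp simp: right_rel_def)
qed

lemma right_rel_mult:
  assumes "((\<alpha>, a), (\<alpha>', a')) \<in> right_rel M" "((\<beta>, b), (\<beta>', b')) \<in> right_rel M"
  shows "((gmult M \<alpha> a \<beta>, b), (gmult M \<alpha>' a' \<beta>', b')) \<in> right_rel M"
proof -
  have mem: "\<alpha> \<in> gcarrier M" "a \<in> scarrier M" "\<alpha>' \<in> gcarrier M" "a' \<in> scarrier M"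
    "\<beta> \<in> gcarrier M" "b \<in> scarrier M" "\<beta>' \<in> gcarrier M" "b' \<in> scarrier M"
    and A: "\<And>s. s \<in> scarrier M \<Longrightarrow> smult M s \<alpha> a = smult M s \<alpha>' a'"
      "\<And>\<gamma>. \<gamma> \<in> gcarrier M \<Longrightarrow> gmult M \<alpha> a \<gamma> = gmult M \<alpha>' a' \<gamma>"
    and B: "\<And>s. s \<in> scarrier M \<Longrightarrow> smult M s \<beta> b = smult M s \<beta>' b'"
      "\<And>\<gamma>. \<gamma> \<in> gcarrier M \<Longrightarrow> gmult M \<beta> b \<gamma> = gmult M \<beta>' b' \<gamma>"
    using assms by (auto simp: right_rel_def)
  have "smult M s (gmult M \<alpha> a \<beta>) b = smult M s (gmult M \<alpha>' a' \<beta>') b'"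
    if s: "s \<in> scarrier M" for s
  proof -
    have "smult M s (gmult M \<alpha> a \<beta>) b = smult M (smult M s \<alpha> a) \<beta> b"
      using s mem by (simp add: S_assoc1)
    also have "\<dots> = smult M (smult M s \<alpha>' a') \<beta>' b'"
      using s mem A B by (simp add: S_closed)
    also have "\<dots> = smult M s (gmult M \<alpha>' a' \<beta>') b'"
      using s mem by (simp add: S_assoc1)
    finally show ?thesis .
  qed
  moreover have "gmult M (gmult M \<alpha> a \<beta>) b \<gamma> = gmult M (gmult M \<alpha>' a' \<beta>') b' \<gamma>"
    if g: "\<gamma> \<in> gcarrier M" for \<gamma>
    using g mem A B by (simp add: G_assoc2 G_closed)
  ultimately show ?thesis
    using mem by (auto simp: right_rel_def G_closed)
qed

lemma right_mult_class:
  assumes "\<alpha> \<in> gcarrier M" "a \<in> scarrier M" "\<beta> \<in> gcarrier M" "b \<in> scarrier M"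
  shows "right_mult M (right_class M \<alpha> a) (right_class M \<beta> b) = right_class M (gmult M \<alpha> a \<beta>) b"
proof -
  have refl: "(\<alpha>, a) \<in> right_class M \<alpha> a" "(\<beta>, b) \<in> right_class M \<beta> b"
    using assms by (simp_all add: right_class_def right_rel_def)
  have indep: "right_class M (gmult M \<alpha>' a' \<beta>') b' = right_class M (gmult M \<alpha> a \<beta>) b"
    if "(\<alpha>', a') \<in> right_class M \<alpha> a" "(\<beta>', b') \<in> right_class M \<beta> b" for \<alpha>' a' \<beta>' b'
  proof -
    have "((gmult M \<alpha> a \<beta>, b), (gmult M \<alpha>' a' \<beta>', b')) \<in> right_rel M"
      using that by (intro right_rel_mult) (simp_all add: right_class_def)
    then show ?thesis
      unfolding right_class_def by (rule equiv_class_eq[OF equiv_right_rel, symmetric])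
  qed
  show ?thesis
    unfolding right_mult_def
    by (rule UN_constant_eq[OF refl(1)], clarify, rule UN_constant_eq[OF refl(2)], clarify,
        rule indep)
qed

lemma right_mult_closed:
  assumes "X \<in> right_op M" "Y \<in> right_op M"
  shows "right_mult M X Y \<in> right_op M"
proof -
  obtain \<alpha> a \<beta> b where *: "\<alpha> \<in> gcarrier M" "a \<in> scarrier M" "\<beta> \<in> gcarrier M" "b \<in> scarrier M"
    and XY: "X = right_class M \<alpha> a" "Y = right_class M \<beta> b"
    using assms unfolding right_op_def right_class_def by (elim quotientE) blast
  have "right_class M (gmult M \<alpha> a \<beta>) b \<in> right_op M"
    unfolding right_op_def right_class_def using * by (intro quotientI) (simp add: G_closed)
  then show ?thesis
    unfolding XY right_mult_class[OF *] .
qed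

lemma right_mult_assoc:
  assumes "X \<in> right_op M" "Y \<in> right_op M" "Z \<in> right_op M"
  shows "right_mult M (right_mult M X Y) Z = right_mult M X (right_mult M Y Z)"
proof -
  obtain \<alpha> a \<beta> b \<gamma> c where "\<alpha> \<in> gcarrier M" "a \<in> scarrier M" "\<beta> \<in> gcarrier M" "b \<in> scarrier M"
    "\<gamma> \<in> gcarrier M" "c \<in> scarrier M"
    and "X = right_class M \<alpha> a" "Y = right_class M \<beta> b" "Z = right_class M \<gamma> c"
    using assms unfolding right_op_def right_class_def by (elim quotientE) blast
  then show ?thesis
    by (simp add: right_mult_class G_closed G_assoc2)
qed

end


section \<open>Q-fuzzy subsets and ideals\<close>

definition fuzzy_subset :: "'x set \<Rightarrow> 'q set \<Rightarrow> ('x \<times> 'q \<Rightarrow> real) \<Rightarrow> bool" where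
  "fuzzy_subset X Q \<mu> \<longleftrightarrow> \<mu> \<in> X \<times> Q \<rightarrow> {0..1}"

definition fuzzy_nonempty :: "'x set \<Rightarrow> 'q set \<Rightarrow> ('x \<times> 'q \<Rightarrow> real) \<Rightarrow> bool" where
  "fuzzy_nonempty X Q \<mu> \<longleftrightarrow> (\<exists>x \<in> X. \<exists>q \<in> Q. \<mu> (x, q) \<noteq> 0)"

definition gamma_fuzzy_left_ideal ::
    "('s, 'g) gamma_structure \<Rightarrow> 'q set \<Rightarrow> ('s \<times> 'q \<Rightarrow> real) \<Rightarrow> bool" where
  "gamma_fuzzy_left_ideal M Q \<mu> \<longleftrightarrow>
     fuzzy_subset (scarrier M) Q \<mu> \<and> fuzzy_nonempty (scarrier M) Q \<mu> \<and>
     (\<forall>x \<in> scarrier M. \<forall>y \<in> scarrier M. \<forall>\<gamma> \<in> gcarrier M. \<forall>q \<in> Q. \<mu> (smult M x \<gamma> y, q) \<ge> \<mu> (y, q))"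

definition gamma_fuzzy_right_ideal ::
    "('s, 'g) gamma_structure \<Rightarrow> 'q set \<Rightarrow> ('s \<times> 'q \<Rightarrow> real) \<Rightarrow> bool" where
  "gamma_fuzzy_right_ideal M Q \<mu> \<longleftrightarrow>
     fuzzy_subset (scarrier M) Q \<mu> \<and> fuzzy_nonempty (scarrier M) Q \<mu> \<and>
     (\<forall>x \<in> scarrier M. \<forall>y \<in> scarrier M. \<forall>\<gamma> \<in> gcarrier M. \<forall>q \<in> Q. \<mu> (smult M x \<gamma> y, q) \<ge> \<mu> (x, q))"

definition gamma_fuzzy_ideal ::
    "('s, 'g) gamma_structure \<Rightarrow> 'q set \<Rightarrow> ('s \<times> 'q \<Rightarrow> real) \<Rightarrow> bool" where
  "gamma_fuzzy_ideal M Q \<mu> \<longleftrightarrow> gamma_fuzzy_left_ideal M Q \<mu> \<and> gamma_fuzzy_right_ideal M Q \<mu>"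

definition fuzzy_left_ideal ::
    "'t set \<Rightarrow> ('t \<Rightarrow> 't \<Rightarrow> 't) \<Rightarrow> 'q set \<Rightarrow> ('t \<times> 'q \<Rightarrow> real) \<Rightarrow> bool" where
  "fuzzy_left_ideal T m Q \<mu> \<longleftrightarrow> fuzzy_subset T Q \<mu> \<and> fuzzy_nonempty T Q \<mu> \<and>
     (\<forall>x \<in> T. \<forall>y \<in> T. \<forall>q \<in> Q. \<mu> (m x y, q) \<ge> \<mu> (y, q))"

definition fuzzy_right_ideal ::
    "'t set \<Rightarrow> ('t \<Rightarrow> 't \<Rightarrow> 't) \<Rightarrow> 'q set \<Rightarrow> ('t \<times> 'q \<Rightarrow> real) \<Rightarrow> bool" where
  "fuzzy_right_ideal T m Q \<mu> \<longleftrightarrow> fuzzy_subset T Q \<mu> \<and> fuzzy_nonempty T Q \<mu> \<and>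
     (\<forall>x \<in> T. \<forall>y \<in> T. \<forall>q \<in> Q. \<mu> (m x y, q) \<ge> \<mu> (x, q))"

definition fuzzy_ideal ::
    "'t set \<Rightarrow> ('t \<Rightarrow> 't \<Rightarrow> 't) \<Rightarrow> 'q set \<Rightarrow> ('t \<times> 'q \<Rightarrow> real) \<Rightarrow> bool" where
  "fuzzy_ideal T m Q \<mu> \<longleftrightarrow> fuzzy_left_ideal T m Q \<mu> \<and> fuzzy_right_ideal T m Q \<mu>"

definition star ::
    "('s, 'g) gamma_structure \<Rightarrow> (('g \<times> 's) set \<times> 'q \<Rightarrow> real) \<Rightarrow> 's \<times> 'q \<Rightarrow> real" where
  "star M \<mu> = (\<lambda>(a, q). INF \<gamma> \<in> gcarrier M. \<mu> (right_class M \<gamma> a, q))"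

end

theory Submission
  imports Defs
begin

text \<open>Everything rests on the identity
  \<open>[\<gamma>, x\<alpha>y] = [\<gamma>x\<alpha>, y] = [\<gamma>, x][\<alpha>, y]\<close> in \<open>R\<close>.
  If \<open>\<mu>\<close> is a left ideal, then \<open>\<mu>[\<gamma>, x\<alpha>y] \<ge> \<mu>[\<alpha>, y]\<close> for all \<open>\<gamma>\<close>, so
  \<open>\<mu>*(x\<alpha>y) \<ge> \<mu>[\<alpha>, y] \<ge> \<mu>*(y)\<close>; the first inequality also shows that \<open>\<mu>*\<close> is not identically \<open>0\<close>.
  If \<open>\<mu>\<close> is a right ideal, then \<open>\<mu>[\<gamma>, x\<alpha>y] \<ge> \<mu>[\<gamma>, x] \<ge> \<mu>*(x)\<close>.\<close>

context gamma_semigroup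
begin

lemma right_class_in_right_op:
  assumes "\<alpha> \<in> gcarrier M" "a \<in> scarrier M"
  shows "right_class M \<alpha> a \<in> right_op M"
  unfolding right_op_def right_class_def using assms by (intro quotientI) simp

lemma right_op_cases:
  assumes "X \<in> right_op M"
  obtains \<alpha> a where "\<alpha> \<in> gcarrier M" "a \<in> scarrier M" "X = right_class M \<alpha> a"
  using assms unfolding right_op_def right_class_def by (elim quotientE) blast

text \<open>The pairs \<open>(\<gamma>, x\<alpha>y)\<close> and
  \<open>(\<gamma>x\<alpha>, y)\<close> act alike on \<open>S\<close> by \<open>S_assoc2\<close> and
  on \<open>\<Gamma>\<close> by \<open>G_assoc1\<close>.\<close>

lemma right_class_smult:
  assumes "\<gamma> \<in> gcarrier M" "x \<in> scarrier M" "\<alpha> \<in> gcarrier M" "y \<in> scarrier M"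
  shows "right_class M \<gamma> (smult M x \<alpha> y) = right_mult M (right_class M \<gamma> x) (right_class M \<alpha> y)"
proof -
  have "((\<gamma>, smult M x \<alpha> y), (gmult M \<gamma> x \<alpha>, y)) \<in> right_rel M"
    using assms by (simp add: right_rel_def S_closed G_closed S_assoc2 G_assoc1)
  then have "right_class M \<gamma> (smult M x \<alpha> y) = right_class M (gmult M \<gamma> x \<alpha>) y"
    unfolding right_class_def by (rule equiv_class_eq[OF equiv_right_rel])
  then show ?thesis
    using assms by (simp add: right_mult_class)
qed

lemma fuzzy_subset_right_class:
  assumes "fuzzy_subset (right_op M) Q \<mu>" "\<gamma> \<in> gcarrier M" "a \<in> scarrier M" "q \<in> Q"
  shows "0 \<le> \<mu> (right_class M \<gamma> a, q)" "\<mu> (right_class M \<gamma> a, q) \<le> 1"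
  using assms right_class_in_right_op[of \<gamma> a] by (auto simp: fuzzy_subset_def Pi_iff)

text \<open>A real infimum is below its members only if the family is bounded below; the bound here
  is 0.\<close>

lemma star_lower:
  assumes "fuzzy_subset (right_op M) Q \<mu>" "\<gamma> \<in> gcarrier M" "a \<in> scarrier M" "q \<in> Q"
  shows "star M \<mu> (a, q) \<le> \<mu> (right_class M \<gamma> a, q)"
proof -
  have "bdd_below ((\<lambda>\<gamma>. \<mu> (right_class M \<gamma> a, q)) ` gcarrier M)"
    using fuzzy_subset_right_class(1)[OF assms(1) _ assms(3,4)] by (intro bdd_belowI2)
  then show ?thesis
    using assms by (auto simp: star_def intro: cINF_lower)
qed

lemma star_greatest:
  assumes "\<And>\<gamma>. \<gamma> \<in> gcarrier M \<Longrightarrow> c \<le> \<mu> (right_class M \<gamma> a, q)"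
  shows "c \<le> star M \<mu> (a, q)"
  using assms G_nonempty by (auto simp: star_def intro: cINF_greatest)

lemma fuzzy_subset_star:
  assumes "fuzzy_subset (right_op M) Q \<mu>"
  shows "fuzzy_subset (scarrier M) Q (star M \<mu>)"
proof -
  \<comment> \<open>The bound 1 on the infimum comes from its value at one fixed
    \<open>\<gamma>\<close>.\<close>
  obtain \<gamma> where \<gamma>: "\<gamma> \<in> gcarrier M"
    using G_nonempty by blast
  have "0 \<le> star M \<mu> (a, q) \<and> star M \<mu> (a, q) \<le> 1" if "a \<in> scarrier M" "q \<in> Q" for a q
    using star_greatest[of 0 \<mu> a q] fuzzy_subset_right_class[OF assms _ that]
      star_lower[OF assms \<gamma> that] \<gamma> by (meson order_trans)
  then show ?thesis
    by (auto simp: fuzzy_subset_def)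
qed

text \<open>The right factor \<open>[\<alpha>, y]\<close> of \<open>[\<gamma>, x\<alpha>y]\<close>
  does not depend on \<open>\<gamma>\<close>, so a single value of \<open>\<mu>\<close> bounds the
  whole infimum.\<close>

lemma star_left_ideal_bound:
  assumes "fuzzy_left_ideal (right_op M) (right_mult M) Q \<mu>"
    and "x \<in> scarrier M" "\<alpha> \<in> gcarrier M" "y \<in> scarrier M" "q \<in> Q"
  shows "\<mu> (right_class M \<alpha> y, q) \<le> star M \<mu> (smult M x \<alpha> y, q)"
  using assms
  by (intro star_greatest) (simp add: right_class_smult fuzzy_left_ideal_def right_class_in_right_op)

text \<open>An infimum of values that are not all 0 may still be 0, so
  \<open>\<mu>[\<alpha>, a] \<noteq> 0\<close> says nothing about \<open>\<mu>*(a)\<close>; the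
  witness is a product ending in \<open>\<alpha>a\<close>.\<close>

lemma fuzzy_nonempty_star:
  assumes "fuzzy_left_ideal (right_op M) (right_mult M) Q \<mu>"
  shows "fuzzy_nonempty (scarrier M) Q (star M \<mu>)"
proof -
  have sub: "fuzzy_subset (right_op M) Q \<mu>" and "fuzzy_nonempty (right_op M) Q \<mu>"
    using assms by (simp_all add: fuzzy_left_ideal_def)
  then obtain \<alpha> a q where mem: "\<alpha> \<in> gcarrier M" "a \<in> scarrier M" "q \<in> Q"
    and "\<mu> (right_class M \<alpha> a, q) \<noteq> 0"
    unfolding fuzzy_nonempty_def by (metis right_op_cases)
  moreover have "0 \<le> \<mu> (right_class M \<alpha> a, q)"
    using fuzzy_subset_right_class(1)[OF sub mem] .
  \<comment> \<open>Any left factor from \<open>S\<close> would do; \<open>a\<close> is at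
    hand.\<close>
  moreover have "\<mu> (right_class M \<alpha> a, q) \<le> star M \<mu> (smult M a \<alpha> a, q)"
    using assms mem by (intro star_left_ideal_bound)
  ultimately have "star M \<mu> (smult M a \<alpha> a, q) \<noteq> 0"
    by linarith
  then show ?thesis
    unfolding fuzzy_nonempty_def using mem S_closed by blast
qed

lemma gamma_fuzzy_left_ideal_star:
  assumes "fuzzy_left_ideal (right_op M) (right_mult M) Q \<mu>"
  shows "gamma_fuzzy_left_ideal M Q (star M \<mu>)"
proof -
  have sub: "fuzzy_subset (right_op M) Q \<mu>"
    using assms by (simp add: fuzzy_left_ideal_def)
  have "star M \<mu> (y, q) \<le> star M \<mu> (smult M x \<gamma> y, q)"
    if "x \<in> scarrier M" "y \<in> scarrier M" "\<gamma> \<in> gcarrier M" "q \<in> Q" for x y \<gamma> q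
    using star_lower[OF sub that(3,2,4)] star_left_ideal_bound[OF assms that(1,3,2,4)]
    by (rule order_trans)
  then show ?thesis
    using fuzzy_subset_star[OF sub] fuzzy_nonempty_star[OF assms]
    by (simp add: gamma_fuzzy_left_ideal_def)
qed

lemma gamma_fuzzy_ideal_star:
  assumes "fuzzy_ideal (right_op M) (right_mult M) Q \<mu>"
  shows "gamma_fuzzy_ideal M Q (star M \<mu>)"
proof -
  have left: "fuzzy_left_ideal (right_op M) (right_mult M) Q \<mu>"
    and right: "fuzzy_right_ideal (right_op M) (right_mult M) Q \<mu>"
    using assms by (simp_all add: fuzzy_ideal_def)
  have sub: "fuzzy_subset (right_op M) Q \<mu>"
    using left by (simp add: fuzzy_left_ideal_def)
  have "star M \<mu> (x, q) \<le> star M \<mu> (smult M x \<alpha> y, q)"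
    if mem: "x \<in> scarrier M" "y \<in> scarrier M" "\<alpha> \<in> gcarrier M" "q \<in> Q" for x y \<alpha> q
  \<comment> \<open>The left factor \<open>[\<gamma>, x]\<close> varies with
    \<open>\<gamma>\<close>, so the comparison is made for each \<open>\<gamma>\<close>
    separately.\<close>
  proof (rule star_greatest)
    fix \<gamma> assume \<gamma>: "\<gamma> \<in> gcarrier M"
    have "star M \<mu> (x, q) \<le> \<mu> (right_class M \<gamma> x, q)"
      using star_lower[OF sub \<gamma> mem(1,4)] .
    also have "\<dots> \<le> \<mu> (right_class M \<gamma> (smult M x \<alpha> y), q)"
      using right mem \<gamma>
      by (simp add: right_class_smult fuzzy_right_ideal_def right_class_in_right_op)
    finally show "star M \<mu> (x, q) \<le> \<mu> (right_class M \<gamma> (smult M x \<alpha> y), q)" .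
  qed
  then show ?thesis
    \<comment> \<open>Range and non-emptiness for the right ideal are taken from the left
      one.\<close>
    using gamma_fuzzy_left_ideal_star[OF left]
    by (simp add: gamma_fuzzy_ideal_def gamma_fuzzy_right_ideal_def gamma_fuzzy_left_ideal_def)
qed

end

theorem proposition5p9:
  fixes M :: "('s, 'g) gamma_structure"
    and Q :: "'q set"
    and \<mu> :: "('g \<times> 's) set \<times> 'q \<Rightarrow> real"
  assumes "gamma_semigroup M"
    and "with_unities M"
    and "Q \<noteq> {}"
  shows "(fuzzy_ideal (right_op M) (right_mult M) Q \<mu> \<longrightarrow> gamma_fuzzy_ideal M Q (star M \<mu>)) \<and>
    (fuzzy_left_ideal (right_op M) (right_mult M) Q \<mu> \<longrightarrow> gamma_fuzzy_left_ideal M Q (star M \<mu>))"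
  using gamma_semigroup.gamma_fuzzy_ideal_star[OF assms(1)]
    gamma_semigroup.gamma_fuzzy_left_ideal_star[OF assms(1)] by blast

end
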